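(* Let $p>2$ be a prime number and let $G\neq\{e\}$ be a finite $p$-group. Then there exists a characteristic subgroup $N$ of $G$ such that: (1) $\log_2|G:N|\leq (b(G)+2)\,f^{b(G)+1}(b(G)\log_2 p)$, where $f^k$ denotes the $k$-th iterate of the function $f(x)=x(x+1)$; (2) $cl(N)\leq b(N)+1$.
   Context: For a finite $p$-group $K$ and $x\in K$, $b(x)=\log_p|K:Z_K(x)|$ where $Z_K(x)$ is the centralizer of $x$ in $K$, and $b(K):=\max_{x\in K}b(x)$ (so $b(N)$ is the breadth of $N$ as a group in its own right). $cl(N)$ denotes the nilpotency class of $N$. *)

theory Defs
  imports "HOL-Algebra.Algebra"
begin

definition centralizer :: "('a, 'b) monoid_scheme \<Rightarrow> 'a \<Rightarrow> 'a set" where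
  "centralizer K x = {y \<in> carrier K. x \<otimes>\<^bsub>K\<^esub> y = y \<otimes>\<^bsub>K\<^esub> x}"

definition breadth_elem :: "nat \<Rightarrow> ('a, 'b) monoid_scheme \<Rightarrow> 'a \<Rightarrow> real" where
  "breadth_elem p K x =
     log (real p) (real (card (carrier K)) / real (card (centralizer K x)))"

definition breadth :: "nat \<Rightarrow> ('a, 'b) monoid_scheme \<Rightarrow> real" where
  "breadth p K = Max (breadth_elem p K ` carrier K)"

definition commutator_set :: "('a, 'b) monoid_scheme \<Rightarrow> 'a set \<Rightarrow> 'a set \<Rightarrow> 'a set" where
  "commutator_set K A B =
     (\<Union>x \<in> A. \<Union>y \<in> B. {x \<otimes>\<^bsub>K\<^esub> y \<otimes>\<^bsub>K\<^esub> inv\<^bsub>K\<^esub> x \<otimes>\<^bsub>K\<^esub> inv\<^bsub>K\<^esub> y})"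

text \<open>lower_central K 0 = gamma_1(K) = K, lower_central K (Suc n) = [gamma_(n+1)(K), K].\<close>
fun lower_central :: "('a, 'b) monoid_scheme \<Rightarrow> nat \<Rightarrow> 'a set" where
  "lower_central K 0 = carrier K"
| "lower_central K (Suc n) = generate K (commutator_set K (lower_central K n) (carrier K))"

definition nil_class :: "('a, 'b) monoid_scheme \<Rightarrow> nat" where
  "nil_class K = (LEAST c. lower_central K c = {\<one>\<^bsub>K\<^esub>})"

definition characteristic :: "('a, 'b) monoid_scheme \<Rightarrow> 'a set \<Rightarrow> bool" where
  "characteristic G N \<longleftrightarrow> subgroup N G \<and> (\<forall>\<phi> \<in> auto G. \<phi> ` N = N)"

definition ff :: "real \<Rightarrow> real" where
  "ff x = x * (x + 1)"

end

theory Submission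
  imports Defs
begin

text \<open>
  Take \<open>N\<close> to be the centralizer of the commutator subgroup: it is characteristic of class at most 2,
  so (2) is immediate, and only its index has to be bounded. Let \<open>b\<close> be the breadth and \<open>a\<close> an
  element of maximal breadth. If the group generated by \<open>b\<close> elements \<open>T\<close> acts transitively on the
  class of \<open>a\<close>, then for \<open>u\<close> in the centralizer \<open>U\<close> of \<open>T\<close> the class of \<open>ua\<close> is exactly \<open>u\<close> times the
  class of \<open>a\<close>, so every commutator of \<open>u\<close> is a quotient of two conjugates of \<open>a\<close>. As \<open>U\<close> has index
  at most \<open>p^(b^2)\<close>, it generates \<open>G\<close> together with \<open>b^2\<close> elements \<open>S\<close>, and \<open>G'\<close> lies in the
  normal closure of \<open>S \<union> {a}\<close>. Each conjugacy class is centralized by the centralizer of \<open>b + 1\<close>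
  elements, hence \<open>N\<close> contains the centralizer of \<open>(b^2 + 1)(b + 1)\<close> elements, each of which
  costs a factor of at most \<open>p^b\<close> in the index.
\<close>

section \<open>Counting by fibres and the product formula for subgroups\<close>

lemma card_constant_fibres:
  assumes "finite A" and "\<And>y. y \<in> f ` A \<Longrightarrow> card {x \<in> A. f x = y} = m"
  shows "card A = card (f ` A) * m"
proof -
  have "card A = (\<Sum>y\<in>f ` A. card {x \<in> A. f x = y})"
    using sum.image_gen[OF assms(1), of "\<lambda>_. 1::nat" f] by simp
  then show ?thesis using assms(2) by simp
qed

text \<open>Defined for arbitrary sets: it is applied to finite sets, whose size controls the index,
  and to the bare set of commutators, whose centralizer is that of the commutator subgroup.\<close>

definition cent :: "('a, 'b) monoid_scheme \<Rightarrow> 'a set \<Rightarrow> 'a set" where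
  "cent G F = {x \<in> carrier G. \<forall>y\<in>F. x \<otimes>\<^bsub>G\<^esub> y = y \<otimes>\<^bsub>G\<^esub> x}"

definition conj_class :: "('a, 'b) monoid_scheme \<Rightarrow> 'a \<Rightarrow> 'a set" where
  "conj_class G a = (\<lambda>g. g \<otimes>\<^bsub>G\<^esub> a \<otimes>\<^bsub>G\<^esub> inv\<^bsub>G\<^esub> g) ` carrier G"

context group
begin

text \<open>All fibres of multiplication \<open>H \<times> K \<rightarrow> H <#> K\<close> have the
  size of \<open>H \<inter> K\<close>: the pairs with product \<open>h \<otimes> k\<close> are the
  \<open>(h \<otimes> d, inv d \<otimes> k)\<close> with \<open>d\<close> in the intersection. The
  product is treated as a set, as neither factor is assumed normal.\<close>

lemma card_set_mult:
  assumes "subgroup H G" "subgroup K G" "finite (carrier G)"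
  shows "card H * card K = card (H <#> K) * card (H \<inter> K)"
proof -
  interpret H: subgroup H G by fact
  interpret K: subgroup K G by fact
  have fin: "finite H" "finite K"
    using assms(3) H.subset K.subset by (auto intro: finite_subset)
  define f where "f = (\<lambda>(x, y). x \<otimes> y)"
  have img: "f ` (H \<times> K) = H <#> K"
    by (auto simp: f_def set_mult_def)
  have "card {x \<in> H \<times> K. f x = z} = card (H \<inter> K)" if z: "z \<in> f ` (H \<times> K)" for z
  proof -
    obtain h k where hk: "h \<in> H" "k \<in> K" "z = h \<otimes> k"
      using z by (auto simp: f_def)
    have "bij_betw (\<lambda>d. (h \<otimes> d, inv d \<otimes> k)) (H \<inter> K) {x \<in> H \<times> K. f x = z}"
    proof (rule bij_betw_byWitness[where f' = "\<lambda>(x, y). inv h \<otimes> x"])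
      show "\<forall>d\<in>H \<inter> K. (\<lambda>(x, y). inv h \<otimes> x) (h \<otimes> d, inv d \<otimes> k) = d"
        using hk by (simp add: m_assoc[symmetric])
      have "h \<otimes> d \<otimes> (inv d \<otimes> k) = z" if d: "d \<in> H" "d \<in> K" for d
      proof -
        have "h \<otimes> d \<otimes> (inv d \<otimes> k) = h \<otimes> (d \<otimes> inv d) \<otimes> k"
          using d hk by (simp only: m_assoc H.mem_carrier K.mem_carrier m_closed inv_closed)
        then show ?thesis using d hk by simp
      qed
      then show "(\<lambda>d. (h \<otimes> d, inv d \<otimes> k)) ` (H \<inter> K) \<subseteq> {x \<in> H \<times> K. f x = z}"
        using hk by (auto simp: f_def)
      \<comment> \<open>The left side lies in \<open>H\<close> and the right side in
        \<open>K\<close>, so this element is the required \<open>d\<close>.\<close>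
      have *: "inv h \<otimes> x = k \<otimes> inv y" if "x \<in> H" "y \<in> K" "x \<otimes> y = h \<otimes> k" for x y
      proof -
        have "x = h \<otimes> k \<otimes> inv y"
          using that hk by (metis H.mem_carrier K.mem_carrier inv_solve_right m_closed)
        then show ?thesis
          using that hk by (simp add: m_assoc[symmetric])
      qed
      have "h \<otimes> (inv h \<otimes> x) = x \<and> inv (inv h \<otimes> x) \<otimes> k = y"
        if xy: "x \<in> H" "y \<in> K" "f (x, y) = z" for x y
      proof -
        have e: "inv h \<otimes> x = k \<otimes> inv y" using * hk xy by (simp add: f_def)
        have "h \<otimes> (inv h \<otimes> x) = x"
          using xy hk by (simp add: m_assoc[symmetric])
        moreover have "inv (inv h \<otimes> x) \<otimes> k = y"
          unfolding e using xy hk by (simp add: inv_mult_group m_assoc)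
        ultimately show ?thesis by simp
      qed
      then show "\<forall>x\<in>{x \<in> H \<times> K. f x = z}. (h \<otimes> (case x of (x, y) \<Rightarrow> inv h \<otimes> x),
          inv (case x of (x, y) \<Rightarrow> inv h \<otimes> x) \<otimes> k) = x"
        by auto
      have "inv h \<otimes> x \<in> K" if xy: "x \<in> H" "y \<in> K" "f (x, y) = z" for x y
      proof -
        have "inv h \<otimes> x = k \<otimes> inv y" using * hk xy by (simp add: f_def)
        then show ?thesis using xy hk by simp
      qed
      then show "(\<lambda>(x, y). inv h \<otimes> x) ` {x \<in> H \<times> K. f x = z} \<subseteq> H \<inter> K"
        using hk by auto
    qed
    then show ?thesis by (simp add: bij_betw_same_card)
  qed
  then have "card (H \<times> K) = card (f ` (H \<times> K)) * card (H \<inter> K)"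
    using fin by (intro card_constant_fibres) auto
  then show ?thesis by (simp add: img card_cartesian_product)
qed

section \<open>Centralizers of sets\<close>

lemma mem_cent: "x \<in> cent G F \<longleftrightarrow> x \<in> carrier G \<and> (\<forall>y\<in>F. x \<otimes> y = y \<otimes> x)"
  by (simp add: cent_def)

lemma subgroup_cent:
  assumes "F \<subseteq> carrier G"
  shows "subgroup (cent G F) G"
proof (rule subgroupI)
  show "cent G F \<subseteq> carrier G" by (auto simp: cent_def)
  show "cent G F \<noteq> {}" using assms one_closed by (force simp: cent_def)
next
  fix x assume x: "x \<in> cent G F"
  have "inv x \<otimes> y = y \<otimes> inv x" if "y \<in> F" for y
  proof -
    have c: "x \<in> carrier G" "y \<in> carrier G" "x \<otimes> y = y \<otimes> x"
      using x that assms by (auto simp: cent_def)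
    have "inv x \<otimes> y = inv x \<otimes> (y \<otimes> x) \<otimes> inv x"
      using c(1,2) by (simp add: m_assoc)
    also have "\<dots> = inv x \<otimes> (x \<otimes> y) \<otimes> inv x" using c by simp
    also have "\<dots> = y \<otimes> inv x" using c(1,2) by (simp add: m_assoc[symmetric])
    finally show ?thesis .
  qed
  then show "inv x \<in> cent G F" using x by (simp add: mem_cent)
next
  fix x y assume x: "x \<in> cent G F" and y: "y \<in> cent G F"
  have "x \<otimes> y \<otimes> z = z \<otimes> (x \<otimes> y)" if "z \<in> F" for z
    using x y that assms by (simp add: mem_cent subset_iff) (metis m_assoc)
  then show "x \<otimes> y \<in> cent G F" using x y by (simp add: mem_cent)
qed

text \<open>The elements commuting with \<open>x\<close> form a subgroup; as it contains
  \<open>F\<close>, it contains \<open>generate G F\<close>.\<close>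

lemma generate_subset_cent:
  assumes "F \<subseteq> carrier G" "x \<in> cent G F" "y \<in> generate G F"
  shows "x \<otimes> y = y \<otimes> x"
proof -
  have x: "x \<in> carrier G" using assms(2) by (simp add: mem_cent)
  have "F \<subseteq> cent G {x}" using assms by (auto simp: mem_cent)
  then have "generate G F \<subseteq> cent G {x}"
    by (rule generate_subgroup_incl) (simp add: subgroup_cent x)
  then show ?thesis using assms(3) by (auto simp: mem_cent)
qed

section \<open>Conjugacy classes and their sizes\<close>

lemma centralizer_eq_cent: "centralizer G x = cent G {x}"
  by (auto simp: centralizer_def cent_def)

text \<open>Orbit-stabilizer: the elements conjugating \<open>a\<close> to
  \<open>g \<otimes> a \<otimes> inv g\<close> form the left coset of \<open>cent G {a}\<close>
  through \<open>g\<close>.\<close>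

lemma card_conj_class:
  assumes "finite (carrier G)" "a \<in> carrier G"
  shows "card (carrier G) = card (conj_class G a) * card (cent G {a})"
  unfolding conj_class_def
proof (rule card_constant_fibres[OF assms(1)])
  fix y assume "y \<in> (\<lambda>g. g \<otimes> a \<otimes> inv g) ` carrier G"
  then obtain g where g: "g \<in> carrier G" "y = g \<otimes> a \<otimes> inv g" by auto
  have "{x \<in> carrier G. x \<otimes> a \<otimes> inv x = y} = (\<lambda>c. g \<otimes> c) ` cent G {a}"
  proof (intro equalityI subsetI)
    fix x assume "x \<in> {x \<in> carrier G. x \<otimes> a \<otimes> inv x = y}"
    then have x: "x \<in> carrier G" "x \<otimes> a \<otimes> inv x = g \<otimes> a \<otimes> inv g" using g by auto
    have "inv g \<otimes> x \<otimes> a = inv g \<otimes> (x \<otimes> a \<otimes> inv x) \<otimes> x"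
      using x(1) g(1) assms(2) by (simp add: m_assoc)
    also have "\<dots> = a \<otimes> (inv g \<otimes> x)"
      unfolding x(2) using x(1) g(1) assms(2)
      by (simp add: m_assoc[symmetric])
    finally have "inv g \<otimes> x \<in> cent G {a}" using x g by (simp add: mem_cent)
    moreover have "x = g \<otimes> (inv g \<otimes> x)" using x(1) g(1) by (simp add: m_assoc[symmetric])
    ultimately show "x \<in> (\<lambda>c. g \<otimes> c) ` cent G {a}" by blast
  next
    fix x assume "x \<in> (\<lambda>c. g \<otimes> c) ` cent G {a}"
    then obtain c where c: "c \<in> carrier G" "c \<otimes> a = a \<otimes> c" "x = g \<otimes> c"
      by (auto simp: mem_cent)
    have "x \<otimes> a \<otimes> inv x = g \<otimes> (c \<otimes> a) \<otimes> inv c \<otimes> inv g"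
      using c(1,3) g(1) assms(2) by (simp add: inv_mult_group m_assoc)
    also have "\<dots> = y"
      unfolding c(2) using c(1) g assms(2) by (simp add: m_assoc)
    finally show "x \<in> {x \<in> carrier G. x \<otimes> a \<otimes> inv x = y}" using c g by simp
  qed
  moreover have "inj_on (\<lambda>c. g \<otimes> c) (cent G {a})"
    using g by (auto simp: inj_on_def mem_cent)
  ultimately show "card {x \<in> carrier G. x \<otimes> a \<otimes> inv x = y} = card (cent G {a})"
    by (simp add: card_image)
qed

lemma conj_mult_right:
  assumes "g \<in> carrier G" "c \<in> cent G {a}" "a \<in> carrier G"
  shows "(g \<otimes> c) \<otimes> a \<otimes> inv (g \<otimes> c) = g \<otimes> a \<otimes> inv g"
proof -
  have c: "c \<in> carrier G" "c \<otimes> a = a \<otimes> c" using assms by (auto simp: mem_cent)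
  have "(g \<otimes> c) \<otimes> a \<otimes> inv (g \<otimes> c) = g \<otimes> (c \<otimes> a) \<otimes> inv c \<otimes> inv g"
    using c(1) assms by (simp add: inv_mult_group m_assoc)
  also have "\<dots> = g \<otimes> a \<otimes> inv g"
    unfolding c(2) using c(1) assms by (simp add: m_assoc)
  finally show ?thesis .
qed

text \<open>By transitivity every conjugate of \<open>a\<close> is conjugate to it by an element of
  \<open>generate G T\<close>, hence is a word in \<open>T\<close> and \<open>a\<close>; commuting
  with these generators suffices.\<close>

lemma cent_commutes_conj_class:
  assumes T: "T \<subseteq> carrier G" and a: "a \<in> carrier G"
    and trans: "generate G T <#> cent G {a} = carrier G"
    and x: "x \<in> cent G (insert a T)" and y: "y \<in> conj_class G a"
  shows "x \<otimes> y = y \<otimes> x"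
proof -
  have aT: "insert a T \<subseteq> carrier G" using a T by auto
  obtain g where g: "g \<in> carrier G" "y = g \<otimes> a \<otimes> inv g" using y by (auto simp: conj_class_def)
  then have "g \<in> generate G T <#> cent G {a}" using trans by simp
  then obtain h c where hc: "h \<in> generate G T" "c \<in> cent G {a}" "g = h \<otimes> c"
    by (auto simp: set_mult_def)
  have h: "h \<in> carrier G" using hc(1) T generate_in_carrier by blast
  have y': "y = h \<otimes> a \<otimes> inv h" using conj_mult_right[OF h hc(2) a] g hc by simp
  have sub: "subgroup (generate G (insert a T)) G" using generate_is_subgroup[OF aT] .
  have "generate G T \<subseteq> generate G (insert a T)" by (rule mono_generate) auto
  then have "h \<in> generate G (insert a T)" using hc by auto
  moreover have "a \<in> generate G (insert a T)" by (rule generate.incl) simp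
  ultimately have "y \<in> generate G (insert a T)"
    unfolding y' using sub by (simp add: subgroup.m_closed subgroup.m_inv_closed)
  then show ?thesis using generate_subset_cent[OF aT x] by simp
qed

text \<open>The class of \<open>u \<otimes> a\<close> contains \<open>u\<close> times the class of \<open>a\<close>, which already has the maximal size.\<close>

lemma commutator_of_maximal_class:
  assumes fin: "finite (carrier G)" and T: "T \<subseteq> carrier G" and a: "a \<in> carrier G"
    and trans: "generate G T <#> cent G {a} = carrier G"
    and max: "\<And>x. x \<in> carrier G \<Longrightarrow> card (conj_class G x) \<le> card (conj_class G a)"
    and u: "u \<in> cent G T" and y: "y \<in> carrier G"
  shows "\<exists>z\<in>conj_class G a. inv u \<otimes> y \<otimes> u \<otimes> inv y = z \<otimes> inv (y \<otimes> a \<otimes> inv y)"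
proof -
  have uc: "u \<in> carrier G" using u by (simp add: mem_cent)
  \<comment> \<open>Transitivity allows a conjugator \<open>h\<close> in
    \<open>generate G T\<close>. As \<open>u\<close> commutes with \<open>h\<close>, multiplying
    \<open>h \<otimes> a \<otimes> inv h\<close> by \<open>u\<close> gives a conjugate of
    \<open>u \<otimes> a\<close>.\<close>
  have "(\<lambda>z. u \<otimes> z) ` conj_class G a \<subseteq> conj_class G (u \<otimes> a)"
  proof clarify
    fix z assume "z \<in> conj_class G a"
    then obtain g where g: "g \<in> carrier G" "z = g \<otimes> a \<otimes> inv g" by (auto simp: conj_class_def)
    then have "g \<in> generate G T <#> cent G {a}" using trans by simp
    then obtain h c where hc: "h \<in> generate G T" "c \<in> cent G {a}" "g = h \<otimes> c"
      by (auto simp: set_mult_def)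
    have h: "h \<in> carrier G" using hc(1) T generate_in_carrier by blast
    have "u \<otimes> z = u \<otimes> h \<otimes> a \<otimes> inv h"
      using conj_mult_right[OF h hc(2) a] g hc uc h a by (simp add: m_assoc)
    also have "\<dots> = h \<otimes> (u \<otimes> a) \<otimes> inv h"
      using generate_subset_cent[OF T u hc(1)] uc h a by (simp add: m_assoc)
    finally show "u \<otimes> z \<in> conj_class G (u \<otimes> a)" using h by (auto simp: conj_class_def)
  qed
  moreover have "finite (conj_class G (u \<otimes> a))" using fin by (simp add: conj_class_def)
  moreover have "card ((\<lambda>z. u \<otimes> z) ` conj_class G a) = card (conj_class G a)"
    using uc a by (intro card_image) (auto simp: inj_on_def conj_class_def)
  moreover have "card (conj_class G (u \<otimes> a)) \<le> card (conj_class G a)"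
    using max uc a by simp
  ultimately have eq: "(\<lambda>z. u \<otimes> z) ` conj_class G a = conj_class G (u \<otimes> a)"
    by (intro card_seteq) auto
  \<comment> \<open>By the equality just obtained, this conjugate is \<open>u \<otimes> z\<close>
    for some \<open>z\<close> in the class of \<open>a\<close>. Solving for \<open>z\<close> and
    dividing by \<open>y \<otimes> a \<otimes> inv y\<close> cancels \<open>a\<close> and leaves the
    commutator.\<close>
  have "y \<otimes> (u \<otimes> a) \<otimes> inv y \<in> conj_class G (u \<otimes> a)" using y by (auto simp: conj_class_def)
  then obtain z where z: "z \<in> conj_class G a" "y \<otimes> (u \<otimes> a) \<otimes> inv y = u \<otimes> z"
    using eq by auto
  have zc: "z \<in> carrier G" using z(1) a by (auto simp: conj_class_def)
  have "z = inv u \<otimes> (y \<otimes> (u \<otimes> a) \<otimes> inv y)"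
    unfolding z(2) using uc zc by (simp add: m_assoc[symmetric])
  then have "z \<otimes> inv (y \<otimes> a \<otimes> inv y) = inv u \<otimes> y \<otimes> u \<otimes> inv y"
    using uc y a by (simp add: inv_mult_group m_assoc inv_solve_left)
      (simp add: m_assoc[symmetric])
  then show ?thesis using z(1) by metis
qed

text \<open>The index of an intersection is at most the product of the indices, so each element of
  \<open>F\<close> costs at most a factor \<open>n\<close>. The bound is multiplicative to stay
  within the natural numbers.\<close>

lemma card_le_card_cent:
  assumes fin: "finite (carrier G)"
    and max: "\<And>x. x \<in> carrier G \<Longrightarrow> card (conj_class G x) \<le> n"
    and F: "finite F" "F \<subseteq> carrier G"
  shows "card (carrier G) \<le> card (cent G F) * n ^ card F"
  using F
proof (induction F rule: finite_induct)
  case empty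
  then show ?case by (simp add: cent_def)
next
  case (insert a F)
  let ?A = "cent G {a}" and ?C = "cent G F"
  have a: "a \<in> carrier G" and F: "F \<subseteq> carrier G" using insert by auto
  have Int: "?A \<inter> ?C = cent G (insert a F)" by (auto simp: mem_cent)
  have sub: "subgroup ?A G" "subgroup ?C G" using a F by (auto intro: subgroup_cent)
  have "card ?A * card ?C = card (?A <#> ?C) * card (?A \<inter> ?C)"
    using card_set_mult[OF sub fin] .
  also have "\<dots> \<le> card (carrier G) * card (?A \<inter> ?C)"
    using fin sub by (intro mult_right_mono card_mono) (auto simp: setmult_subset_G subgroup.subset)
  also have "\<dots> \<le> card ?A * (n * card (?A \<inter> ?C))"
    using card_conj_class[OF fin a] max[OF a] by simp
  finally have "card ?A * card ?C \<le> card ?A * (n * card (?A \<inter> ?C))" .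
  moreover have "card ?A > 0"
    using sub(1) fin subgroup.finite_imp_card_positive by blast
  ultimately have "card ?C \<le> n * card (?A \<inter> ?C)" by simp
  then have "card ?C * n ^ card F \<le> n * card (?A \<inter> ?C) * n ^ card F" by (rule mult_right_mono) simp
  with insert.IH[OF F] have "card (carrier G) \<le> n * card (?A \<inter> ?C) * n ^ card F" by (rule order_trans)
  then show ?case using insert.hyps unfolding Int by (simp add: ac_simps)
qed

section \<open>Normal closures and a characteristic centralizer\<close>

text \<open>A union of conjugacy classes is closed under conjugation, so the subgroup it generates
  is normal; this one serves as the normal closure of \<open>C\<close>.\<close>

lemma normal_generate_conj_classes:
  assumes "C \<subseteq> carrier G"
  shows "generate G (\<Union>c\<in>C. conj_class G c) \<lhd> G"
proof (rule normal_generateI)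
  show "(\<Union>c\<in>C. conj_class G c) \<subseteq> carrier G" using assms by (auto simp: conj_class_def)
  fix h g assume h: "h \<in> (\<Union>c\<in>C. conj_class G c)" and g: "g \<in> carrier G"
  then obtain c k where c: "c \<in> C" "k \<in> carrier G" "h = k \<otimes> c \<otimes> inv k" by (auto simp: conj_class_def)
  have "g \<otimes> h \<otimes> inv g = (g \<otimes> k) \<otimes> c \<otimes> inv (g \<otimes> k)"
    using c g assms by (auto simp: inv_mult_group m_assoc subset_iff)
  then show "g \<otimes> h \<otimes> inv g \<in> (\<Union>c\<in>C. conj_class G c)"
    using c g by (auto simp: conj_class_def)
qed

text \<open>An automorphism is surjective, so every commutator is the image of a commutator and the
  centralizer is mapped into itself. Injectivity and finiteness turn this inclusion into
  equality.\<close>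

lemma characteristic_cent_commutators:
  assumes fin: "finite (carrier G)"
  shows "characteristic G (cent G (commutator_set G (carrier G) (carrier G)))"
    (is "characteristic G ?N")
  unfolding characteristic_def
proof (intro conjI ballI)
  show "subgroup ?N G" by (rule subgroup_cent) (auto simp: commutator_set_def)
  fix \<phi> assume "\<phi> \<in> auto G"
  then have hom: "\<phi> \<in> hom G G" and bij: "bij_betw \<phi> (carrier G) (carrier G)"
    by (auto simp: auto_def Bij_def)
  interpret h: group_hom G G \<phi> by unfold_locales (rule hom)
  have "\<phi> x \<in> ?N" if x: "x \<in> ?N" for x
    unfolding mem_cent
  proof (intro conjI ballI)
    have xc: "x \<in> carrier G" using x by (simp add: mem_cent)
    then show "\<phi> x \<in> carrier G" by simp
    fix y assume "y \<in> commutator_set G (carrier G) (carrier G)"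
    then obtain g k where gk: "g \<in> carrier G" "k \<in> carrier G" "y = g \<otimes> k \<otimes> inv g \<otimes> inv k"
      by (auto simp: commutator_set_def)
    have img: "\<phi> ` carrier G = carrier G" using bij by (simp add: bij_betw_def)
    obtain g' k' where gk': "g' \<in> carrier G" "k' \<in> carrier G" "g = \<phi> g'" "k = \<phi> k'"
      using gk(1,2) img by (metis imageE)
    let ?c = "g' \<otimes> k' \<otimes> inv g' \<otimes> inv k'"
    have y: "y = \<phi> ?c" using gk gk' by simp
    have "?c \<in> commutator_set G (carrier G) (carrier G)"
      using gk' by (auto simp: commutator_set_def)
    then have "\<phi> (x \<otimes> ?c) = \<phi> (?c \<otimes> x)" using x by (simp add: mem_cent)
    then show "\<phi> x \<otimes> y = y \<otimes> \<phi> x"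
      unfolding y using xc gk' by (simp only: h.hom_mult m_closed inv_closed)
  qed
  moreover have "inj_on \<phi> ?N" using bij by (auto simp: bij_betw_def inj_on_def mem_cent)
  moreover have "finite ?N" using fin by (simp add: cent_def)
  ultimately show "\<phi> ` ?N = ?N" by (intro endo_inj_surj) auto
qed

end

section \<open>Finite p-groups and generation modulo a subgroup\<close>

locale finite_p_group = group +
  fixes p :: nat
  assumes prime_p: "Factorial_Ring.prime p"
    and fin: "finite (carrier G)"
    and order_p_power: "\<exists>n. card (carrier G) = p ^ n"
begin

lemma p_gt_1: "p > 1"
  using prime_p by (rule prime_gt_1_nat)

lemma p_power_of_dvd:
  assumes "(d :: nat) dvd p ^ n"
  shows "\<exists>i. d = p ^ i"
  using assms divides_primepow_nat[OF prime_p] by blast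

lemma card_subgroup_p_power:
  assumes "subgroup H G"
  shows "\<exists>i. card H = p ^ i"
proof -
  have "card H dvd card (carrier G)"
    using lagrange[OF assms] by (metis dvd_triv_right order_def)
  then show ?thesis using order_p_power p_power_of_dvd by metis
qed

text \<open>\<open>H <#> K\<close> need not be a subgroup, so Lagrange does not apply to it; the
  product formula shows instead that its size divides a power of \<open>p\<close>.\<close>

lemma card_set_mult_p_power:
  assumes "subgroup H G" "subgroup K G"
  shows "\<exists>i. card (H <#> K) = p ^ i"
proof -
  obtain i j where "card H = p ^ i" "card K = p ^ j"
    using assms card_subgroup_p_power by metis
  then have "p ^ (i + j) = card (H <#> K) * card (H \<inter> K)"
    using card_set_mult[OF assms fin] by (simp add: power_add)
  then have "card (H <#> K) dvd p ^ (i + j)" by simp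
  then show ?thesis by (rule p_power_of_dvd)
qed

text \<open>Each new generator enlarges the set \<open>\<langle>T\<rangle>H\<close>, whose size is a power of \<open>p\<close>, at least by the factor \<open>p\<close>.\<close>

lemma few_generators_modulo_subgroup:
  assumes H: "subgroup H G" and le: "card (carrier G) \<le> card H * p ^ k"
  shows "\<exists>T. T \<subseteq> carrier G \<and> finite T \<and> card T \<le> k \<and> generate G T <#> H = carrier G"
proof -
  have sub: "generate G T <#> H \<subseteq> carrier G" if "T \<subseteq> carrier G" for T
    using that H by (simp add: setmult_subset_G generate_incl subgroup.subset)
  \<comment> \<open>Elements are added one at a time until the product is all of
    \<open>carrier G\<close>. At \<open>n = k\<close> the second alternative also gives this, since
    the product then has at least as many elements as the group.\<close>
  have "\<exists>T. T \<subseteq> carrier G \<and> finite T \<and> card T \<le> n \<and>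
      (generate G T <#> H = carrier G \<or> card H * p ^ n \<le> card (generate G T <#> H))" for n
  proof (induction n)
    case 0
    have "generate G {} <#> H = H"
      using H by (simp add: generate_empty set_mult_def subgroup.mem_carrier)
    then show ?case by (intro exI[of _ "{}"]) auto
  next
    case (Suc n)
    then obtain T where T: "T \<subseteq> carrier G" "finite T" "card T \<le> n"
      and alt: "generate G T <#> H = carrier G \<or> card H * p ^ n \<le> card (generate G T <#> H)"
      by blast
    show ?case
    proof (cases "generate G T <#> H = carrier G")
      case True
      with T show ?thesis by (intro exI[of _ T]) auto
    next
      case False
      then obtain t where t: "t \<in> carrier G" "t \<notin> generate G T <#> H" using sub[OF T(1)] by blast
      let ?T = "insert t T"
      have T': "?T \<subseteq> carrier G" using t T by simp
      have "t \<otimes> \<one> \<in> generate G ?T <#> H"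
        using H subgroup.one_closed generate.incl[of t ?T G] unfolding set_mult_def by blast
      moreover have "generate G T <#> H \<subseteq> generate G ?T <#> H"
        using mono_generate[of T ?T] by (auto simp: set_mult_def)
      ultimately have "generate G T <#> H \<subset> generate G ?T <#> H" using t by auto
      then have less: "card (generate G T <#> H) < card (generate G ?T <#> H)"
        using sub[OF T'] fin by (meson psubset_card_mono finite_subset)
      obtain i j where ij: "card (generate G T <#> H) = p ^ i" "card (generate G ?T <#> H) = p ^ j"
        using card_set_mult_p_power[OF generate_is_subgroup[OF T(1)] H]
          card_set_mult_p_power[OF generate_is_subgroup[OF T'] H] by blast
      then have "Suc i \<le> j" using less p_gt_1 by simp
      then have "p ^ Suc i \<le> p ^ j" using p_gt_1 by (intro power_increasing) auto
      moreover have "card H * p ^ n \<le> p ^ i" using alt False ij by simp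
      then have "card H * p ^ Suc n \<le> p ^ Suc i" by simp
      ultimately have "card H * p ^ Suc n \<le> card (generate G ?T <#> H)" using ij by linarith
      moreover have "card ?T \<le> Suc n" using T by (simp add: card_insert_if)
      ultimately show ?thesis using T T' by blast
    qed
  qed
  then obtain T where T: "T \<subseteq> carrier G" "finite T" "card T \<le> k"
    and alt: "generate G T <#> H = carrier G \<or> card H * p ^ k \<le> card (generate G T <#> H)" by blast
  then have "generate G T <#> H = carrier G"
    using le sub[OF T(1)] fin by (metis card_seteq order_trans)
  with T show ?thesis by blast
qed

section \<open>Breadth as the exponent of the largest class size\<close>

lemma breadth_elem_eq:
  assumes "x \<in> carrier G"
  shows "breadth_elem p G x = log p (card (conj_class G x))"
proof -
  have "subgroup (cent G {x}) G" using assms by (simp add: subgroup_cent)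
  then have "card (cent G {x}) > 0" using fin subgroup.finite_imp_card_positive by blast
  then show ?thesis
    by (simp add: breadth_elem_def centralizer_eq_cent card_conj_class[OF fin assms])
qed

lemma conj_class_finite: "finite (conj_class G x)"
  using fin by (simp add: conj_class_def)

lemma conj_class_card_pos: "card (conj_class G x) > 0"
  using conj_class_finite carrier_not_empty by (auto simp: card_gt_0_iff conj_class_def)

text \<open>Class sizes divide the group order and so are powers of \<open>p\<close>. The logarithm
  is monotone, so the real-valued breadth is the natural exponent \<open>B\<close> of the largest
  class size.\<close>

lemma breadth_witness:
  obtains a B where "a \<in> carrier G" "breadth p G = real B" "card (conj_class G a) = p ^ B"
    "\<And>x. x \<in> carrier G \<Longrightarrow> card (conj_class G x) \<le> p ^ B"
proof -
  let ?M = "Max ((\<lambda>x. card (conj_class G x)) ` carrier G)"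
  have ne: "(\<lambda>x. card (conj_class G x)) ` carrier G \<noteq> {}" using carrier_not_empty by simp
  have "?M \<in> (\<lambda>x. card (conj_class G x)) ` carrier G" using fin ne by (intro Max_in) auto
  then obtain a where a: "a \<in> carrier G" "card (conj_class G a) = ?M" by auto
  have max: "card (conj_class G x) \<le> card (conj_class G a)" if "x \<in> carrier G" for x
    unfolding a(2) using that fin by (intro Max_ge) auto
  have "card (conj_class G a) dvd card (carrier G)"
    using card_conj_class[OF fin a(1)] by simp
  then obtain B where B: "card (conj_class G a) = p ^ B"
    using order_p_power p_power_of_dvd by metis
  have "breadth p G = breadth_elem p G a"
    unfolding breadth_def
  proof (rule Max_eqI)
    fix y assume "y \<in> breadth_elem p G ` carrier G"
    then obtain x where x: "x \<in> carrier G" "y = breadth_elem p G x" by auto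
    then show "y \<le> breadth_elem p G a"
      using max[OF x(1)] p_gt_1 conj_class_card_pos by (simp add: breadth_elem_eq a(1))
  qed (use fin a in auto)
  also have "\<dots> = real B"
    using p_gt_1 by (simp add: breadth_elem_eq a(1) B log_nat_power)
  finally show thesis using that a(1) B max by metis
qed

section \<open>Breadth of groups of class at most two\<close>

text \<open>Central commutators force class at most 2. An abelian group has class at most 1 and
  breadth at least 0; a nonabelian one has a class with more than one element, so its breadth is at
  least 1.\<close>

lemma nil_class_le_of_central_commutators:
  assumes central: "commutator_set G (carrier G) (carrier G) \<subseteq> cent G (carrier G)"
  shows "real (nil_class G) \<le> breadth p G + 1"
proof -
  obtain B where B: "breadth p G = real B" "\<And>x. x \<in> carrier G \<Longrightarrow> card (conj_class G x) \<le> p ^ B"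
    using breadth_witness by metis
  have trivial: "generate G (commutator_set G A (carrier G)) = {\<one>}" if "A \<subseteq> cent G (carrier G)" for A
  proof -
    have "x \<otimes> y \<otimes> inv x \<otimes> inv y = \<one>" if "x \<in> A" "y \<in> carrier G" for x y
    proof -
      have "x \<in> carrier G" "x \<otimes> y = y \<otimes> x" using that \<open>A \<subseteq> _\<close> by (auto simp: mem_cent)
      then show ?thesis using that(2) by (simp add: m_assoc)
    qed
    then have "commutator_set G A (carrier G) \<subseteq> {\<one>}" by (auto simp: commutator_set_def)
    then have "generate G (commutator_set G A (carrier G)) \<subseteq> generate G {\<one>}" by (rule mono_generate)
    then show ?thesis using generate.one[of G] by (auto simp: generate_one)
  qed
  show ?thesis
  proof (cases "carrier G \<subseteq> cent G (carrier G)")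
    case True
    \<comment> \<open>Indexing starts at 0 with the whole group, so index 1 is the commutator
      subgroup.\<close>
    then have "lower_central G 1 = {\<one>}" using trivial by simp
    then have "nil_class G \<le> 1" unfolding nil_class_def by (rule Least_le)
    then show ?thesis using B by simp
  next
    case False
    then obtain x y where xy: "x \<in> carrier G" "y \<in> carrier G" "x \<otimes> y \<noteq> y \<otimes> x"
      unfolding subset_iff mem_cent by blast
    have "B \<noteq> 0"
    proof
      assume "B = 0"
      then have "card (conj_class G x) = 1" using B(2)[OF xy(1)] conj_class_card_pos[of x] by simp
      then have "card (carrier G) = card (cent G {x})" using card_conj_class[OF fin xy(1)] by simp
      then have "cent G {x} = carrier G" using fin by (intro card_subset_eq) (auto simp: mem_cent)
      then have "y \<in> cent G {x}" using xy by simp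
      then show False using xy by (simp add: mem_cent)
    qed
    have "generate G (commutator_set G (carrier G) (carrier G)) \<subseteq> cent G (carrier G)"
      by (rule generate_subgroup_incl[OF central]) (simp add: subgroup_cent)
    then have "lower_central G 2 = {\<one>}" using trivial by (simp add: numeral_2_eq_2)
    then have "nil_class G \<le> 2" unfolding nil_class_def by (rule Least_le)
    then show ?thesis using B \<open>B \<noteq> 0\<close> by simp
  qed
qed

section \<open>Index of the centralizer of the commutators\<close>

lemma card_le_card_cent_commutators:
  assumes b: "breadth p G = real B"
  shows "card (carrier G) \<le>
    card (cent G (commutator_set G (carrier G) (carrier G))) * p ^ (B * ((B * B + 1) * (B + 1)))"
proof -
  obtain a where a: "a \<in> carrier G" "card (conj_class G a) = p ^ B"
    and max: "\<And>x. x \<in> carrier G \<Longrightarrow> card (conj_class G x) \<le> p ^ B"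
    using breadth_witness b by (metis of_nat_eq_iff)
  \<comment> \<open>\<open>cent G {c}\<close> has index at most \<open>p ^ B\<close>, so
    \<open>B\<close> elements suffice for transitivity on the class of \<open>c\<close>.\<close>
  have "\<exists>T. T \<subseteq> carrier G \<and> finite T \<and> card T \<le> B \<and> generate G T <#> cent G {c} = carrier G"
    if c: "c \<in> carrier G" for c
    using c max[OF c] card_conj_class[OF fin c]
    by (intro few_generators_modulo_subgroup) (auto simp: subgroup_cent)
  then obtain T where T: "\<And>c. c \<in> carrier G \<Longrightarrow> T c \<subseteq> carrier G" "\<And>c. c \<in> carrier G \<Longrightarrow> finite (T c)"
    "\<And>c. c \<in> carrier G \<Longrightarrow> card (T c) \<le> B"
    "\<And>c. c \<in> carrier G \<Longrightarrow> generate G (T c) <#> cent G {c} = carrier G"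
    by metis
  define U where "U = cent G (T a)"
  have U: "subgroup U G" unfolding U_def using T(1)[OF a(1)] by (rule subgroup_cent)
  have "card (carrier G) \<le> card U * (p ^ B) ^ card (T a)"
    unfolding U_def using fin max T(2,1)[OF a(1)] by (rule card_le_card_cent)
  also have "\<dots> \<le> card U * (p ^ B) ^ B"
    using T(3)[OF a(1)] p_gt_1 by (intro mult_left_mono power_increasing) auto
  finally have "card (carrier G) \<le> card U * p ^ (B * B)" by (simp add: power_mult)
  from few_generators_modulo_subgroup[OF U this]
  obtain S where S: "S \<subseteq> carrier G" "finite S" "card S \<le> B * B" "generate G S <#> U = carrier G"
    by blast
  define C where "C = insert a S"
  have C: "C \<subseteq> carrier G" "finite C" "card C \<le> B * B + 1"
    using a S by (auto simp: C_def card_insert_if)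
  define E where "E = generate G (\<Union>c\<in>C. conj_class G c)"
  have E: "E \<lhd> G" unfolding E_def using C(1) by (rule normal_generate_conj_classes)
  interpret E: normal E G by fact
  have conj_E: "conj_class G c \<subseteq> E" if "c \<in> C" for c
    using that unfolding E_def by (auto intro: generate.incl)
  have C_E: "C \<subseteq> E"
  proof
    fix c assume c: "c \<in> C"
    then have "c = \<one> \<otimes> c \<otimes> inv \<one>" using C by auto
    then have "c \<in> conj_class G c" unfolding conj_class_def by blast
    then show "c \<in> E" using conj_E c by blast
  qed
  \<comment> \<open>The result on commutators with elements of \<open>U\<close> is applied to
    \<open>inv u\<close> to obtain this orientation; it gives a quotient of two conjugates of
    \<open>a\<close>, both in \<open>E\<close> because \<open>a\<close> belongs to
    \<open>C\<close>.\<close>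
  have UE: "u \<otimes> y \<otimes> inv u \<otimes> inv y \<in> E" if u: "u \<in> U" and y: "y \<in> carrier G" for u y
  proof -
    have uc: "u \<in> carrier G" and iu: "inv u \<in> cent G (T a)"
      using u subgroup.m_inv_closed[OF U u] by (auto simp: U_def mem_cent)
    obtain z where z: "z \<in> conj_class G a"
      "inv (inv u) \<otimes> y \<otimes> inv u \<otimes> inv y = z \<otimes> inv (y \<otimes> a \<otimes> inv y)"
      using commutator_of_maximal_class[OF fin T(1)[OF a(1)] a(1) T(4)[OF a(1)] _ iu y] max a(2)
      by auto
    have "z \<in> E" "y \<otimes> a \<otimes> inv y \<in> E"
      using conj_E[of a] z(1) y by (auto simp: C_def conj_class_def)
    then show ?thesis using z(2) uc by simp
  qed
  have comm_E: "commutator_set G (carrier G) (carrier G) \<subseteq> E"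
  proof -
    have "x \<otimes> y \<otimes> inv x \<otimes> inv y \<in> E" if x: "x \<in> carrier G" and y: "y \<in> carrier G" for x y
    proof -
      have "x \<in> generate G S <#> U" using x S by simp
      then obtain e u where eu: "e \<in> generate G S" "u \<in> U" "x = e \<otimes> u" by (auto simp: set_mult_def)
      have "generate G S \<subseteq> E"
        by (rule generate_subgroup_incl) (use C_E in \<open>auto simp: C_def E.subgroup_axioms\<close>)
      then have e: "e \<in> E" using eu by auto
      have u: "u \<in> carrier G" by (rule subgroup.mem_carrier[OF U eu(2)])
      \<comment> \<open>Splitting \<open>x = e \<otimes> u\<close> isolates the commutator of
        \<open>u\<close> and \<open>y\<close>; the outer factors lie in \<open>E\<close>, the last
        one by normality.\<close>
      have "x \<otimes> y \<otimes> inv x \<otimes> inv y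
          = e \<otimes> (u \<otimes> y \<otimes> inv u \<otimes> inv y) \<otimes> (y \<otimes> inv e \<otimes> inv y)"
      proof -
        have "(u \<otimes> y \<otimes> inv u \<otimes> inv y) \<otimes> (y \<otimes> inv e \<otimes> inv y)
            = u \<otimes> y \<otimes> inv u \<otimes> (inv y \<otimes> y) \<otimes> inv e \<otimes> inv y"
          using u y E.mem_carrier[OF e] by (simp only: m_assoc m_closed inv_closed)
        then show ?thesis
          unfolding eu(3) using u y E.mem_carrier[OF e] by (simp add: inv_mult_group m_assoc)
      qed
      moreover have "y \<otimes> inv e \<otimes> inv y \<in> E" using e y E.inv_op_closed2 by simp
      ultimately show ?thesis using UE[OF eu(2) y] e by simp
    qed
    then show ?thesis by (auto simp: commutator_set_def)
  qed
  \<comment> \<open>For each of the at most \<open>B * B + 1\<close> elements \<open>c\<close> of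
    \<open>C\<close>, \<open>F\<close> collects \<open>c\<close> and the at most \<open>B\<close>
    elements of \<open>T c\<close>. Commuting with these means commuting with the whole class of
    \<open>c\<close>, hence altogether with \<open>E\<close> and every commutator.\<close>
  define F where "F = (\<Union>c\<in>C. insert c (T c))"
  have F: "F \<subseteq> carrier G" "finite F" using C T by (auto simp: F_def)
  have "card F \<le> (\<Sum>c\<in>C. card (insert c (T c)))"
    unfolding F_def using C(2) by (rule card_UN_le)
  also have "\<dots> \<le> (\<Sum>c\<in>C. B + 1)"
    using C T by (intro sum_mono) (auto simp: card_insert_if subset_iff le_SucI)
  also have "\<dots> \<le> (B * B + 1) * (B + 1)"
    using mult_right_mono[OF C(3), of "B + 1"] by (simp only: sum_constant of_nat_id)
  finally have card_F: "card F \<le> (B * B + 1) * (B + 1)" .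
  have "cent G F \<subseteq> cent G (commutator_set G (carrier G) (carrier G))"
  proof
    fix x assume x: "x \<in> cent G F"
    have sub: "(\<Union>c\<in>C. conj_class G c) \<subseteq> carrier G" using C by (auto simp: conj_class_def)
    have "x \<otimes> y = y \<otimes> x" if c: "c \<in> C" and y: "y \<in> conj_class G c" for c y
    proof -
      have cc: "c \<in> carrier G" using c C by auto
      have "x \<in> cent G (insert c (T c))" using x c unfolding F_def by (auto simp: mem_cent)
      then show ?thesis
        using cent_commutes_conj_class[OF T(1)[OF cc] cc T(4)[OF cc] _ y] by simp
    qed
    then have "x \<in> cent G (\<Union>c\<in>C. conj_class G c)" using x by (auto simp: mem_cent)
    then have "x \<otimes> y = y \<otimes> x" if "y \<in> E" for y
      using generate_subset_cent[OF sub] that unfolding E_def by blast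
    then show "x \<in> cent G (commutator_set G (carrier G) (carrier G))"
      using x comm_E by (auto simp: mem_cent)
  qed
  then have "card (cent G F) \<le> card (cent G (commutator_set G (carrier G) (carrier G)))"
    using fin by (intro card_mono) (auto simp: cent_def)
  moreover have "(p ^ B) ^ card F \<le> (p ^ B) ^ ((B * B + 1) * (B + 1))"
    using card_F p_gt_1 by (intro power_increasing) auto
  ultimately have "card (cent G F) * (p ^ B) ^ card F \<le>
      card (cent G (commutator_set G (carrier G) (carrier G))) * (p ^ B) ^ ((B * B + 1) * (B + 1))"
    by (rule mult_mono) auto
  moreover have "card (carrier G) \<le> card (cent G F) * (p ^ B) ^ card F"
    using fin max F(2,1) by (rule card_le_card_cent)
  ultimately show ?thesis by (simp only: power_mult)
qed

end

section \<open>Comparison with the iterates of \<open>ff\<close>\<close>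

lemma le_funpow_ff:
  assumes "0 \<le> y"
  shows "y \<le> (ff ^^ n) y"
proof (induction n)
  case (Suc n)
  have "0 \<le> (ff ^^ n) y" using Suc assms by simp
  then have "(ff ^^ n) y \<le> ff ((ff ^^ n) y)" by (simp add: ff_def algebra_simps)
  then show ?case using Suc by simp
qed simp

text \<open>With \<open>b = B\<close> and \<open>y = b * L\<close>, the left side is
  \<open>y * (b + 1) * (b * b + 1)\<close>. Two applications of \<open>ff\<close> already dominate
  it: \<open>y \<ge> b\<close> gives \<open>ff y \<ge> y * (b + 1) \<ge> b * b\<close>, and the
  second application multiplies by \<open>ff y + 1\<close>.\<close>

lemma index_exponent_le:
  assumes L: "1 \<le> L"
  shows "real (B * ((B * B + 1) * (B + 1))) * L \<le> (real B + 2) * (ff ^^ (B + 1)) (real B * L)"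
proof (cases B)
  \<comment> \<open>With \<open>B = 0\<close> only one iterate is available, but both sides vanish;
    from \<open>B = 1\<close> on there are at least two.\<close>
  case 0
  then show ?thesis by (simp add: ff_def)
next
  case (Suc n)
  define b y where "b = real B" and "y = b * L"
  have b: "b \<ge> 0" and y: "y \<ge> b" using L by (auto simp: b_def y_def mult_le_cancel_left1)
  have y1: "y * (b + 1) \<le> ff y" unfolding ff_def using y b by (intro mult_left_mono) auto
  have "b * 1 \<le> y * (b + 1)" using y b by (intro mult_mono) auto
  then have "0 \<le> ff y" using y1 b by simp
  have "b * b \<le> y * (b + 1)" using y b by (intro mult_mono) auto
  then have "y * (b + 1) * (b * b + 1) \<le> ff (ff y)"
    unfolding ff_def[of "ff y"] using y1 y b \<open>0 \<le> ff y\<close> by (intro mult_mono) auto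
  \<comment> \<open>The remaining \<open>n = B - 1\<close> iterations do not decrease a nonnegative
    value.\<close>
  also have "\<dots> \<le> (ff ^^ n) (ff (ff y))"
    using \<open>0 \<le> ff y\<close> by (intro le_funpow_ff) (simp add: ff_def)
  also have "\<dots> = (ff ^^ (B + 1)) y" by (simp add: Suc funpow_swap1)
  finally have *: "y * (b + 1) * (b * b + 1) \<le> (ff ^^ (B + 1)) y" .
  have nn: "0 \<le> y * (b + 1) * (b * b + 1)" using y b by simp
  have "y * (b + 1) * (b * b + 1) \<le> (b + 2) * (y * (b + 1) * (b * b + 1))"
    using mult_right_mono[OF _ nn, of 1 "b + 2"] b by simp
  also have "\<dots> \<le> (b + 2) * (ff ^^ (B + 1)) y" using * b by (intro mult_left_mono) auto
  finally have "(b * ((b * b + 1) * (b + 1))) * L \<le> (b + 2) * (ff ^^ (B + 1)) y"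
    by (simp only: y_def ac_simps)
  then show ?thesis
    by (simp only: b_def y_def of_nat_mult of_nat_add of_nat_1)
qed

theorem theorem5:
  fixes G :: "('a, 'b) monoid_scheme" and p :: nat
  assumes "Factorial_Ring.prime p" and "p > 2"
    and "group G" and "finite (carrier G)"
    and "\<exists>n. card (carrier G) = p ^ n"
    and "carrier G \<noteq> {\<one>\<^bsub>G\<^esub>}"
  shows "\<exists>N. characteristic G N
           \<and> log 2 (real (card (carrier G)) / real (card N))
               \<le> (breadth p G + 2) * (ff ^^ (nat \<lfloor>breadth p G\<rfloor> + 1)) (breadth p G * log 2 (real p))
           \<and> real (nil_class (G\<lparr>carrier := N\<rparr>)) \<le> breadth p (G\<lparr>carrier := N\<rparr>) + 1"
proof -
  interpret group G by fact
  interpret finite_p_group G p by unfold_locales (use assms in auto)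
  define N where "N = cent G (commutator_set G (carrier G) (carrier G))"
  have char: "characteristic G N"
    unfolding N_def using fin by (rule characteristic_cent_commutators)
  then have N: "subgroup N G" by (simp add: characteristic_def)
  have Nc: "N \<subseteq> carrier G" using N by (rule subgroup.subset)
  have posN: "card N > 0" using N fin subgroup.finite_imp_card_positive by blast
  have posG: "card (carrier G) > 0" using fin carrier_not_empty by (simp add: card_gt_0_iff)
  obtain B where B: "breadth p G = real B" by (rule breadth_witness)
  define e where "e = B * ((B * B + 1) * (B + 1))"
  have "real (card (carrier G)) \<le> real (card N * p ^ e)"
    using card_le_card_cent_commutators[OF B] unfolding N_def e_def of_nat_le_iff .
  then have "real (card (carrier G)) / real (card N) \<le> real p ^ e"
    using posN by (simp add: divide_le_eq mult.commute)
  then have "log 2 (real (card (carrier G)) / real (card N)) \<le> log 2 (real p ^ e)"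
    using posN posG p_gt_1 by (subst log_le_cancel_iff) auto
  also have "\<dots> = real e * log 2 (real p)" using p_gt_1 by (simp add: log_nat_power)
  \<comment> \<open>The size of \<open>p\<close> enters here, through
    \<open>log 2 p \<ge> 1\<close>.\<close>
  also have "\<dots> \<le> (real B + 2) * (ff ^^ (B + 1)) (real B * log 2 (real p))"
    unfolding e_def using assms(2) by (intro index_exponent_le) (simp add: le_log_iff)
  \<comment> \<open>The breadth is the natural number \<open>B\<close>, so the floor in the
    iteration count leaves it unchanged.\<close>
  finally have index: "log 2 (real (card (carrier G)) / real (card N))
      \<le> (breadth p G + 2) * (ff ^^ (nat \<lfloor>breadth p G\<rfloor> + 1)) (breadth p G * log 2 (real p))"
    by (simp add: B)
  \<comment> \<open>A second instance of the locale, since the breadth and class of \<open>N\<close>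
    are taken inside \<open>N\<close> itself.\<close>
  interpret N: finite_p_group "G\<lparr>carrier := N\<rparr>" p
    using subgroup.subgroup_is_group[OF N group_axioms] finite_subset[OF Nc fin]
      card_subgroup_p_power[OF N] prime_p
    by (simp add: finite_p_group_def finite_p_group_axioms_def)
  have "real (nil_class (G\<lparr>carrier := N\<rparr>)) \<le> breadth p (G\<lparr>carrier := N\<rparr>) + 1"
  proof (rule N.nil_class_le_of_central_commutators, rule subsetI)
    fix z assume "z \<in> commutator_set (G\<lparr>carrier := N\<rparr>) (carrier (G\<lparr>carrier := N\<rparr>)) (carrier (G\<lparr>carrier := N\<rparr>))"
    then obtain x y where xy: "x \<in> N" "y \<in> N" "z = x \<otimes>\<^bsub>G\<^esub> y \<otimes>\<^bsub>G\<^esub> inv\<^bsub>G\<^esub> x \<otimes>\<^bsub>G\<^esub> inv\<^bsub>G\<^esub> y"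
      by (auto simp: commutator_set_def m_inv_consistent[OF N])
    \<comment> \<open>A commutator of elements of \<open>N\<close> is one of \<open>G\<close>, hence
      centralized by \<open>N\<close>; lying also in \<open>N\<close>, it is central there.\<close>
    have "z \<in> commutator_set G (carrier G) (carrier G)"
      using xy Nc by (auto simp: commutator_set_def)
    then have "w \<otimes>\<^bsub>G\<^esub> z = z \<otimes>\<^bsub>G\<^esub> w" if "w \<in> N" for w using that by (simp add: N_def mem_cent)
    moreover have "z \<in> N"
      using xy N by (simp add: subgroup.m_closed subgroup.m_inv_closed)
    ultimately show "z \<in> cent (G\<lparr>carrier := N\<rparr>) (carrier (G\<lparr>carrier := N\<rparr>))"
      by (simp add: N.mem_cent)
  qed
  with char index show ?thesis by blast
qed

end
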